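(* For each natural number $n \geq 1$ there exist a constant $h_n > 0$ and a continuous function $\mathcal{B}_n : [1,\infty) \to [h_n,\infty)$ such that, if $M^n$ is a closed, convex hypersurface in $\mathbb{R}^{n+1}$, $\alpha : M \to M$ is a continuous map without fixed points, $\mu(\alpha) = \min_{x \in M} d_M(x,\alpha(x))$, and $\rho(\alpha) = \max_{x \in M} \frac{d_M(x,\alpha(x))}{|\alpha(x)-x|}$, then $$\mathrm{Area}(M) > \mathcal{B}_n(\rho(\alpha))\, \mu(\alpha)^n.$$
   Context: A closed, convex hypersurface $M^n$ in $\mathbb{R}^{n+1}$ is the boundary of a compact convex set with nonempty interior in $\mathbb{R}^{n+1}$; no smoothness is assumed. $\mathrm{Area}(M)$ is the $n$-dimensional Hausdorff measure of $M$. The intrinsic distance $d_M(x,y)$ is the minimal length of a path contained in $M$ connecting $x$ and $y$, and $|\cdot|$ is the Euclidean norm. *)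

theory Defs
  imports "HOL-Analysis.Analysis"
begin

(* The constant unit_ball_vol n / 2^n normalises the n-dimensional Hausdorff measure so that it
   agrees with Lebesgue measure on R^n. Boundedness of the covering sets is required because
   diameter is unspecified on unbounded sets; the case distinction keeps empty covering sets
   from contributing when n = 0. *)
definition hausdorff_premeasure :: "nat \<Rightarrow> real \<Rightarrow> 'a::metric_space set \<Rightarrow> ennreal" where
  "hausdorff_premeasure n \<delta> S =
     (INF C \<in> {C :: nat \<Rightarrow> 'a set. S \<subseteq> (\<Union>i. C i) \<and> (\<forall>i. bounded (C i) \<and> diameter (C i) \<le> \<delta>)}.
        \<Sum>i. if C i = {} then 0 else ennreal (unit_ball_vol (real n) * (diameter (C i) / 2) ^ n))"

definition hausdorff_measure :: "nat \<Rightarrow> 'a::metric_space set \<Rightarrow> ennreal" where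
  "hausdorff_measure n S = (SUP \<delta> \<in> {0<..}. hausdorff_premeasure n \<delta> S)"

(* Total variation over finite partitions of [0,1], infinite for non-rectifiable paths. *)
definition path_length :: "(real \<Rightarrow> 'a::metric_space) \<Rightarrow> ennreal" where
  "path_length g =
     (SUP ts \<in> {ts :: real list. sorted ts \<and> set ts \<subseteq> {0..1}}.
        ennreal (\<Sum>i<length ts - 1. dist (g (ts ! i)) (g (ts ! Suc i))))"

(* The infimum is the minimal length whenever a shortest path exists, as it does on the compact
   hypersurfaces below; it is infinite if no path in M joins x to y. *)
definition intrinsic_dist :: "'a::metric_space set \<Rightarrow> 'a \<Rightarrow> 'a \<Rightarrow> ennreal" where
  "intrinsic_dist M x y =
     (INF g \<in> {g. path g \<and> path_image g \<subseteq> M \<and> pathstart g = x \<and> pathfinish g = y}. path_length g)"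

definition closed_convex_hypersurface :: "'a::euclidean_space set \<Rightarrow> bool" where
  "closed_convex_hypersurface M \<longleftrightarrow>
     (\<exists>K. compact K \<and> convex K \<and> interior K \<noteq> {} \<and> M = frontier K)"

(* For continuous \<alpha> without fixed points on such a hypersurface, the infimum and supremum in the
   next two definitions are attained. *)
definition min_displacement :: "'a::metric_space set \<Rightarrow> ('a \<Rightarrow> 'a) \<Rightarrow> ennreal" where
  "min_displacement M \<alpha> = (INF x \<in> M. intrinsic_dist M x (\<alpha> x))"

definition max_distortion :: "'a::real_normed_vector set \<Rightarrow> ('a \<Rightarrow> 'a) \<Rightarrow> ennreal" where
  "max_distortion M \<alpha> = (SUP x \<in> M. intrinsic_dist M x (\<alpha> x) / ennreal (norm (\<alpha> x - x)))"

end

theory Submission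
  imports Defs
begin

text \<open>Let \<open>K\<close> be the convex body bounded by \<open>M\<close>. The idea is to find a length \<open>h\<close> which is small
compared with the area, in the sense that the area is at least a constant times \<open>h ^ n\<close>,
and such that some point of \<open>M\<close> is moved by \<open>\<alpha>\<close> over an intrinsic distance of at most a
constant times \<open>h\<close>. Since this bound on the displacement does not depend on the distortion, the
function \<open>B\<close> can be chosen constant.

The length \<open>h\<close> measures the second smallest extension of \<open>K\<close>: there are orthonormal directions
\<open>e\<close> and \<open>f\<close> in which \<open>K\<close> has width of order \<open>h\<close>, while the projection of \<open>K\<close> to a suitable
\<open>n\<close>-dimensional subspace contains a simplex all of whose successive heights are at least \<open>h\<close>. Both come from
one greedy choice of a simplex (\<open>greedy_dual_system\<close>), and projecting \<open>M\<close> to the subspace gives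
the lower bound for the area (\<open>hausdorff_measure_ge_coordinates\<close>, \<open>area_ge_two_widths\<close>).

A point with small displacement is found by topology: by Brouwer's fixed point theorem some point
\<open>x\<close> of \<open>M\<close> and its image differ by a multiple of \<open>e\<close> (\<open>exists_displacement_parallel\<close>). Such
points are close in the intrinsic distance, because one can travel from one to the other around
the section of \<open>K\<close> by the plane through \<open>x\<close> spanned by \<open>e\<close> and \<open>f\<close>, whose size is of order
\<open>h\<close> (\<open>intrinsic_dist_le_width\<close>).\<close>

section \<open>Intrinsic distance between the ends of a chord\<close>

lemma path_length_le_lipschitz:
  assumes g: "L-lipschitz_on {0..1} g"
  shows "path_length g \<le> ennreal L"
  unfolding path_length_def
proof (rule SUP_least)
  fix ts :: "real list"
  assume "ts \<in> {ts. sorted ts \<and> set ts \<subseteq> {0..1}}"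
  then have s: "sorted ts" and r: "\<And>i. i < length ts \<Longrightarrow> ts ! i \<in> {0..1}"
    by (auto simp: subset_iff)
  have L: "L \<ge> 0" using g by (rule lipschitz_on_nonneg)
  have "(\<Sum>i<length ts - 1. dist (g (ts ! i)) (g (ts ! Suc i)))
        \<le> (\<Sum>i<length ts - 1. L * (ts ! Suc i - ts ! i))"
  proof (rule sum_mono)
    fix i assume "i \<in> {..<length ts - 1}"
    then have i: "i < length ts" "Suc i < length ts" by auto
    have "ts ! i \<le> ts ! Suc i" using s i by (simp add: sorted_iff_nth_mono)
    then show "dist (g (ts ! i)) (g (ts ! Suc i)) \<le> L * (ts ! Suc i - ts ! i)"
      using lipschitz_onD[OF g r[OF i(1)] r[OF i(2)]] by (simp add: dist_real_def)
  qed
  also have "\<dots> = L * (ts ! (length ts - 1) - ts ! 0)"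
    by (simp add: sum_distrib_left[symmetric] sum_lessThan_telescope)
  also have "\<dots> \<le> L"
  proof (cases ts)
    case Nil
    then show ?thesis using L by simp
  next
    case (Cons a as)
    then have "ts ! (length ts - 1) \<in> {0..1}" "ts ! 0 \<in> {0..1}" using r[of "length ts - 1"] r[of 0] by simp_all
    then have "ts ! (length ts - 1) - ts ! 0 \<le> 1" by auto
    then show ?thesis using mult_left_mono[OF _ L] by fastforce
  qed
  finally show "ennreal (\<Sum>i<length ts - 1. dist (g (ts ! i)) (g (ts ! Suc i))) \<le> ennreal L"
    by (rule ennreal_leI)
qed

lemma lipschitz_linepath: "(dist a b)-lipschitz_on {0..1} (linepath a b)"
proof (rule lipschitz_onI)
  fix s t :: real
  have "linepath a b s - linepath a b t = (s - t) *\<^sub>R (b - a)"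
    by (simp add: linepath_def algebra_simps)
  then show "dist (linepath a b s) (linepath a b t) \<le> dist a b * dist s t"
    by (simp add: dist_norm norm_minus_commute)
qed simp

lemma lipschitz_joinpaths:
  assumes "L-lipschitz_on {0..1} g1" "L-lipschitz_on {0..1} g2" "pathfinish g1 = pathstart g2"
  shows "(2 * L)-lipschitz_on {0..1} (g1 +++ g2)"
proof -
  have "L \<ge> 0" using assms(1) by (rule lipschitz_on_nonneg)
  have dist_double: "dist (2 * x) (2 * y) = 2 * dist x y"
    and dist_double': "dist (2 * x - 1) (2 * y - 1) = 2 * dist x y" for x y :: real
    unfolding dist_real_def by (auto simp: abs_if)
  have "(2 * L)-lipschitz_on {0..1/2} (\<lambda>x. g1 (2 * x))"
  proof (rule lipschitz_onI)
    fix x y :: real assume "x \<in> {0..1/2}" "y \<in> {0..1/2}"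
    then show "dist (g1 (2 * x)) (g1 (2 * y)) \<le> 2 * L * dist x y"
      using lipschitz_onD[OF assms(1), of "2 * x" "2 * y"]
      by (simp add: dist_double)
  qed (use \<open>L \<ge> 0\<close> in simp)
  moreover have "(2 * L)-lipschitz_on {1/2..1} (\<lambda>x. g2 (2 * x - 1))"
  proof (rule lipschitz_onI)
    fix x y :: real assume "x \<in> {1/2..1}" "y \<in> {1/2..1}"
    then show "dist (g2 (2 * x - 1)) (g2 (2 * y - 1)) \<le> 2 * L * dist x y"
      using lipschitz_onD[OF assms(2), of "2 * x - 1" "2 * y - 1"]
      by (simp add: dist_double')
  qed (use \<open>L \<ge> 0\<close> in simp)
  ultimately show ?thesis
    using lipschitz_on_concat[of "2 * L" 0 "1/2" "\<lambda>x. g1 (2 * x)" 1 "\<lambda>x. g2 (2 * x - 1)"] assms(3)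
    by (simp add: joinpaths_def pathfinish_def pathstart_def)
qed

text \<open>The nearest-point map onto a closed convex set does not increase distances and sends every
point outside the interior to the frontier. A path avoiding the interior can therefore be pushed
onto the frontier without becoming longer, which bounds intrinsic distances by the lengths of
explicit polygons instead of by the lengths of convex curves.\<close>

lemma intrinsic_dist_le_outer_path:
  fixes K :: "'a::euclidean_space set"
  assumes K: "compact K" "convex K" and xy: "x \<in> K" "y \<in> K"
    and g: "L-lipschitz_on {0..1} g" "pathstart g = x" "pathfinish g = y"
    and out: "path_image g \<inter> interior K = {}"
  shows "intrinsic_dist (frontier K) x y \<le> ennreal L"
proof -
  let ?p = "closest_point K"
  have ne: "K \<noteq> {}" and cl: "closed K" using xy K by (auto simp: compact_imp_closed)
  have lip: "L-lipschitz_on {0..1} (?p \<circ> g)"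
    using lipschitz_on_compose[OF g(1) lipschitz_onI[of _ ?p 1]] closest_point_lipschitz[OF K(2) cl ne]
    by simp
  have "?p z \<in> frontier K" if "z \<notin> interior K" for z
  proof -
    have "?p z \<in> K" by (rule closest_point_in_set[OF cl ne])
    moreover have "?p z \<notin> interior K"
    proof
      assume *: "?p z \<in> interior K"
      then have "?p z \<noteq> z" using that by metis
      then have "z \<notin> K" using closest_point_self by metis
      moreover have "z \<in> affine hull K"
        using affine_hull_nonempty_interior[of K] * by auto
      ultimately have "?p z \<notin> rel_interior K"
        using closest_point_in_rel_interior[OF cl ne, of z] rel_interior_subset by blast
      then show False using * interior_subset_rel_interior by blast
    qed
    ultimately show ?thesis using closure_subset by (auto simp: frontier_def)
  qed
  then have "path_image (?p \<circ> g) \<subseteq> frontier K"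
    using out by (auto simp: path_image_def)
  moreover have "path (?p \<circ> g)"
    using lipschitz_on_continuous_on[OF lip] by (simp add: path_def)
  ultimately have "intrinsic_dist (frontier K) x y \<le> path_length (?p \<circ> g)"
    unfolding intrinsic_dist_def using g(2,3) xy
    by (intro INF_lower) (auto simp: pathstart_def pathfinish_def closest_point_self)
  also have "\<dots> \<le> ennreal L" using lip by (rule path_length_le_lipschitz)
  finally show ?thesis .
qed

text \<open>Two boundary points on a line parallel to \<open>e\<close> are joined by going around \<open>K\<close> in the plane
spanned by \<open>e\<close> and \<open>f\<close>, so only the widths in these two directions matter. A segment missing
the interior is itself a suitable path. If the segment between the points meets the interior, they are the ends of their chord; the line may then be
followed outwards from both, and the two outer points are connected by a tent whose sides stay
clear of \<open>K\<close>. The polygon consists of four edges of length at most \<open>12 * h\<close>, and parametrising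
each on a quarter of the unit interval gives the constant 48.\<close>

lemma intrinsic_dist_le_width:
  fixes K :: "'a::euclidean_space set"
  assumes K: "compact K" "convex K"
    and e: "norm e = 1" and f: "norm f = 1" and ef: "e \<bullet> f = 0"
    and width_e: "\<And>z. z \<in> K \<Longrightarrow> \<bar>(z - p) \<bullet> e\<bar> \<le> h"
    and width_f: "\<And>z. z \<in> K \<Longrightarrow> \<bar>(z - p) \<bullet> f\<bar> \<le> h"
    and x: "x \<in> frontier K" and y: "y = x + s *\<^sub>R e" "y \<in> frontier K" and s: "s \<ge> 0" and h: "h > 0"
  shows "intrinsic_dist (frontier K) x y \<le> ennreal (48 * h)"
proof -
  have cl: "closed K" using K(1) by (rule compact_imp_closed)
  have xK: "x \<in> K" and yK: "y \<in> K" and nx: "x \<notin> interior K" and ny: "y \<notin> interior K"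
    using x y cl by (auto simp: frontier_def)
  have ee: "e \<bullet> e = 1" and ff: "f \<bullet> f = 1" and fe: "f \<bullet> e = 0"
    using e f ef by (simp_all add: norm_eq_1 inner_commute)
  have s2: "s \<le> 2 * h"
    using width_e[OF xK] width_e[OF yK] by (simp add: y inner_diff_left inner_left_distrib ee)
  show ?thesis
  proof (cases "closed_segment x y \<inter> interior K = {}")
    case True
    have "(48 * h)-lipschitz_on {0..1} (linepath x y)"
      using lipschitz_linepath by (rule lipschitz_on_le) (use e s s2 in \<open>simp add: y dist_norm\<close>)
    then show ?thesis
      using True xK yK by (intro intrinsic_dist_le_outer_path[OF K]) auto
  next
    case False
    define I where "I = {r. x + r *\<^sub>R e \<in> interior K}"
    have "convex I"
      unfolding convex_def
    proof (intro ballI allI impI)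
      fix a b u v :: real
      assume "a \<in> I" "b \<in> I" "0 \<le> u" "0 \<le> v" "u + v = 1"
      moreover from this have "u *\<^sub>R (x + a *\<^sub>R e) + v *\<^sub>R (x + b *\<^sub>R e) \<in> interior K"
        using convexD[OF convex_interior[OF K(2)]] by (simp add: I_def)
      moreover have "u *\<^sub>R (x + a *\<^sub>R e) + v *\<^sub>R (x + b *\<^sub>R e)
          = (u + v) *\<^sub>R x + (u * a + v * b) *\<^sub>R e"
        by (simp add: scaleR_add_left scaleR_add_right)
      ultimately show "u *\<^sub>R a + v *\<^sub>R b \<in> I" by (simp add: I_def)
    qed
    then have I: "b \<in> I" if "a \<in> I" "c \<in> I" "a \<le> b" "b \<le> c" for a b c
      using that by (metis is_interval_convex_1 mem_is_interval_1_I)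
    from False obtain u where "0 \<le> u" "u \<le> 1" "(1 - u) *\<^sub>R x + u *\<^sub>R y \<in> interior K"
      by (auto simp: in_segment)
    then have "u * s \<in> I" by (simp add: I_def y algebra_simps)
    moreover have "0 \<le> u * s" "u * s \<le> s"
      using s \<open>0 \<le> u\<close> \<open>u \<le> 1\<close> by (simp_all add: mult_left_le_one_le)
    moreover have "0 \<notin> I" "s \<notin> I" using nx ny by (auto simp: I_def y)
    ultimately have ray: "x + r *\<^sub>R e \<notin> interior K" if "r \<le> 0 \<or> s \<le> r" for r
      using I[of r "u * s" 0] I[of "u * s" r s] that unfolding I_def by blast
    \<comment> \<open>On \<open>K\<close> the functional \<open>f + \<sigma> *\<^sub>R e\<close> exceeds its value at \<open>p\<close> by at most \<open>2 * h\<close>,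
      so a segment whose ends lie beyond this level misses \<open>K\<close>.\<close>
    have half: "closed_segment a b \<inter> interior K = {}"
      if "\<bar>\<sigma>\<bar> = 1" "(a - p) \<bullet> (f + \<sigma> *\<^sub>R e) > 2 * h" "(b - p) \<bullet> (f + \<sigma> *\<^sub>R e) > 2 * h" for a b \<sigma>
    proof -
      let ?H = "{z. (f + \<sigma> *\<^sub>R e) \<bullet> z > 2 * h + (f + \<sigma> *\<^sub>R e) \<bullet> p}"
      have "closed_segment a b \<subseteq> ?H"
        using that(2,3) by (intro closed_segment_subset convex_halfspace_gt)
          (simp_all add: inner_diff_right inner_commute[of _ "f + \<sigma> *\<^sub>R e"])
      moreover have "z \<notin> ?H" if z: "z \<in> K" for z
      proof -
        have "\<sigma> = 1 \<or> \<sigma> = -1" using \<open>\<bar>\<sigma>\<bar> = 1\<close> by linarith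
        then have "(z - p) \<bullet> (f + \<sigma> *\<^sub>R e) \<le> 2 * h"
          using width_e[OF z] width_f[OF z] by (auto simp: inner_right_distrib inner_diff_right)
        then show ?thesis by (simp add: inner_diff_right inner_commute[of _ "f + \<sigma> *\<^sub>R e"])
      qed
      ultimately show ?thesis using interior_subset by blast
    qed
    \<comment> \<open>The value of \<open>f + \<sigma> *\<^sub>R e\<close> at a point of \<open>K\<close> may be as low as \<open>-2 * h\<close> relative to \<open>p\<close>;
      adding \<open>5 * h\<close> lifts it above the level \<open>2 * h\<close>.\<close>
    define c where "c = 5 * h"
    define A V D where "A = x - c *\<^sub>R e" and "V = x + c *\<^sub>R f" and "D = y + c *\<^sub>R e"
    note bounds = width_e[OF xK] width_f[OF xK] width_e[OF yK] width_f[OF yK]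
    have out1: "closed_segment x A \<inter> interior K = {}"
    proof -
      have "z \<notin> interior K" if "z \<in> closed_segment x A" for z
      proof -
        from that obtain u where "0 \<le> u" "z = x + (- (u * c)) *\<^sub>R e"
          by (auto simp: in_segment A_def algebra_simps)
        then show ?thesis using ray[of "- (u * c)"] h by (simp add: c_def)
      qed
      then show ?thesis by auto
    qed
    have out2: "closed_segment A V \<inter> interior K = {}"
      using bounds h by (intro half[of "-1"])
        (auto simp: A_def V_def c_def inner_simps ee ff ef fe)
    have out3: "closed_segment V D \<inter> interior K = {}"
      using bounds h by (intro half[of 1])
        (auto simp: V_def D_def c_def inner_simps ee ff ef fe)
    have out4: "closed_segment D y \<inter> interior K = {}"
    proof -
      have "z \<notin> interior K" if "z \<in> closed_segment D y" for z
      proof -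
        from that obtain u where "u \<le> 1" "z = x + (s + (1 - u) * c) *\<^sub>R e"
          by (auto simp: in_segment D_def y algebra_simps)
        then show ?thesis using ray[of "s + (1 - u) * c"] h by (simp add: c_def)
      qed
      then show ?thesis by auto
    qed
    have "dist x A \<le> 12 * h" using e h by (simp add: A_def dist_norm c_def)
    moreover have "dist A V \<le> 12 * h"
    proof -
      have "V - A = c *\<^sub>R e + c *\<^sub>R f" by (simp add: A_def V_def)
      then have "norm (V - A) \<le> norm (c *\<^sub>R e) + norm (c *\<^sub>R f)"
        by (metis norm_triangle_ineq)
      then show ?thesis using e f h by (simp add: dist_norm norm_minus_commute c_def)
    qed
    moreover have "dist V D \<le> 12 * h"
    proof -
      have "D - V = (s + c) *\<^sub>R e - c *\<^sub>R f" by (simp add: V_def D_def y algebra_simps)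
      then have "norm (D - V) \<le> norm ((s + c) *\<^sub>R e) + norm (c *\<^sub>R f)"
        by (metis norm_triangle_ineq4)
      then show ?thesis using e f h s s2 by (simp add: dist_norm norm_minus_commute c_def)
    qed
    moreover have "dist D y \<le> 12 * h" using e h by (simp add: D_def dist_norm c_def)
    ultimately have "(2 * (2 * (12 * h)))-lipschitz_on {0..1}
        ((linepath x A +++ linepath A V) +++ (linepath V D +++ linepath D y))"
      by (intro lipschitz_joinpaths lipschitz_on_le[OF lipschitz_linepath]) auto
    moreover have "path_image ((linepath x A +++ linepath A V) +++ (linepath V D +++ linepath D y))
        \<inter> interior K = {}"
      using out1 out2 out3 out4 by (auto simp: path_image_join)
    ultimately show ?thesis
      using intrinsic_dist_le_outer_path[OF K xK yK] by fastforce
  qed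
qed

section \<open>A point displaced in a prescribed direction\<close>

text \<open>If the orthogonal projection along \<open>e\<close> had a continuous section into the upper boundary of
\<open>K\<close>, then composing it with \<open>\<alpha>\<close> and the projection would give a self-map of the shadow, and
a fixed point of that map would be the claim. The upper boundary is given by a concave function,
which is continuous only in the interior and can jump at the rim of the shadow. Hence the points
are first contracted towards an interior point \<open>q\<close> by the factor \<open>1 - \<epsilon>\<close>. Brouwer's theorem on
\<open>K\<close> then gives a boundary point whose displacement is parallel to \<open>e\<close> up to an error of order
\<open>\<epsilon>\<close>, and compactness of the frontier removes the error.\<close>

lemma exists_displacement_parallel:
  fixes K :: "'a::euclidean_space set"
  assumes K: "compact K" "convex K" "interior K \<noteq> {}"
    and \<alpha>: "continuous_on (frontier K) \<alpha>" "\<alpha> ` frontier K \<subseteq> frontier K" and e: "norm e = 1"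
  obtains x s where "x \<in> frontier K" "\<alpha> x = x + s *\<^sub>R e"
proof -
  have cl: "closed K" using K(1) by (rule compact_imp_closed)
  then have frK: "frontier K \<subseteq> K" by (rule frontier_subset_closed)
  obtain q where q: "q \<in> interior K" using K(3) by auto
  obtain B where B: "B > 0" "\<And>z. z \<in> K \<Longrightarrow> norm z \<le> B"
    using compact_imp_bounded[OF K(1)] by (auto simp: bounded_pos)
  define T where "T z = {t. z + t *\<^sub>R e \<in> K}" for z
  define top where "top z = Sup (T z)" for z
  have cT: "compact (T z)" for z
  proof -
    have "closed (T z)"
      unfolding T_def using continuous_closed_vimage[OF cl, of "\<lambda>t. z + t *\<^sub>R e"]
      by (simp add: vimage_def)
    moreover have "norm t \<le> B + norm z" if "t \<in> T z" for t
      using B(2)[of "z + t *\<^sub>R e"] that norm_triangle_ineq2[of "t *\<^sub>R e" "- z"] e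
      by (simp add: T_def add.commute)
    ultimately show ?thesis by (auto simp: compact_eq_bounded_closed bounded_iff)
  qed
  have le_top: "t \<le> top z" if "z + t *\<^sub>R e \<in> K" for z t
    unfolding top_def using cT that
    by (intro cSup_upper bounded_imp_bdd_above compact_imp_bounded) (auto simp: T_def)
  have top_in: "z + top z *\<^sub>R e \<in> K" if "z \<in> K" for z
  proof -
    have "0 \<in> T z" using that by (simp add: T_def)
    then have "top z \<in> T z"
      unfolding top_def using cT
      by (intro closed_contains_Sup bounded_imp_bdd_above compact_imp_bounded compact_imp_closed) auto
    then show ?thesis by (simp add: T_def)
  qed
  have top_frontier: "z + top z *\<^sub>R e \<in> frontier K" if "z \<in> K" for z
  proof -
    have "z + top z *\<^sub>R e \<notin> interior K"
    proof
      assume "z + top z *\<^sub>R e \<in> interior K"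
      then obtain r where r: "r > 0" "cball (z + top z *\<^sub>R e) r \<subseteq> K"
        by (auto simp: mem_interior_cball)
      have "z + (top z + r) *\<^sub>R e \<in> K"
        using r(1) e by (intro subsetD[OF r(2)]) (simp add: dist_norm scaleR_add_left)
      then have "top z + r \<le> top z" by (rule le_top)
      then show False using r(1) by simp
    qed
    then show ?thesis using top_in[OF that] closure_subset by (auto simp: frontier_def)
  qed
  have "convex_on (interior K) (\<lambda>z. - top z)"
  proof (rule convex_onI)
    fix t :: real and a b assume t: "0 < t" "t < 1" and ab: "a \<in> interior K" "b \<in> interior K"
    have "(1 - t) *\<^sub>R (a + top a *\<^sub>R e) + t *\<^sub>R (b + top b *\<^sub>R e) \<in> K"
      using t ab interior_subset by (intro convexD[OF K(2)] top_in) auto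
    then have "((1 - t) *\<^sub>R a + t *\<^sub>R b) + ((1 - t) * top a + t * top b) *\<^sub>R e \<in> K"
      by (simp add: scaleR_add_right scaleR_add_left add.assoc add.left_commute)
    from le_top[OF this]
    show "- top ((1 - t) *\<^sub>R a + t *\<^sub>R b) \<le> (1 - t) * - top a + t * - top b" by simp
  qed (use K(2) in \<open>rule convex_interior\<close>)
  then have "continuous_on (interior K) (\<lambda>z. - (- top z))"
    by (intro continuous_on_minus convex_on_continuous) auto
  then have cont_top: "continuous_on (interior K) top" by simp
  \<comment> \<open>\<open>N x\<close> measures how far the displacement of \<open>x\<close> is from being parallel to \<open>e\<close>.\<close>
  define N where "N x = norm ((\<alpha> x - x) - ((\<alpha> x - x) \<bullet> e) *\<^sub>R e)" for x
  have small: "\<exists>x\<in>frontier K. N x \<le> 4 * B * \<epsilon>" if \<epsilon>: "0 < \<epsilon>" "\<epsilon> \<le> 1" for \<epsilon>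
  proof -
    define F where "F y = (y - \<epsilon> *\<^sub>R (y - q)) + top (y - \<epsilon> *\<^sub>R (y - q)) *\<^sub>R e" for y
    have int: "y - \<epsilon> *\<^sub>R (y - q) \<in> interior K" if "y \<in> K" for y
      using mem_interior_convex_shrink[OF K(2) q that \<epsilon>] .
    then have F: "F y \<in> frontier K" if "y \<in> K" for y
      unfolding F_def using that interior_subset by (blast intro: top_frontier)
    have "continuous_on K (\<lambda>y. top (y - \<epsilon> *\<^sub>R (y - q)))"
      using int by (intro continuous_on_compose2[OF cont_top] continuous_intros) auto
    then have "continuous_on K F" unfolding F_def by (intro continuous_intros)
    then have "continuous_on K (\<lambda>y. \<alpha> (F y))"
      using F by (intro continuous_on_compose2[OF \<alpha>(1)]) auto
    moreover have "(\<lambda>y. \<alpha> (F y)) \<in> K \<rightarrow> K" using F \<alpha>(2) frK by blast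
    moreover have "K \<noteq> {}" using K(3) by auto
    ultimately obtain y where y: "y \<in> K" "\<alpha> (F y) = y"
      using brouwer[OF K(1,2)] by metis
    let ?d = "y - q" and ?s = "top (y - \<epsilon> *\<^sub>R (y - q))"
    have disp: "\<alpha> (F y) - F y = \<epsilon> *\<^sub>R ?d - ?s *\<^sub>R e" unfolding y(2) by (simp add: F_def)
    have "e \<bullet> e = 1" using e by (simp add: norm_eq_1)
    then have "u - s *\<^sub>R e - ((u - s *\<^sub>R e) \<bullet> e) *\<^sub>R e = u - (u \<bullet> e) *\<^sub>R e" for u s
      by (simp add: inner_diff_left scaleR_diff_left)
    then have "N (F y) = norm (\<epsilon> *\<^sub>R ?d - (\<epsilon> *\<^sub>R ?d \<bullet> e) *\<^sub>R e)"
      unfolding N_def disp by presburger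
    also have "\<dots> \<le> norm (\<epsilon> *\<^sub>R ?d) + norm ((\<epsilon> *\<^sub>R ?d \<bullet> e) *\<^sub>R e)" by (rule norm_triangle_ineq4)
    also have "\<dots> \<le> norm (\<epsilon> *\<^sub>R ?d) + norm (\<epsilon> *\<^sub>R ?d)"
      using Cauchy_Schwarz_ineq2[of "\<epsilon> *\<^sub>R ?d" e] e by simp
    also have "\<dots> = 2 * norm ?d * \<epsilon>" using \<epsilon> by simp
    also have "\<dots> \<le> 2 * (2 * B) * \<epsilon>"
      using B(2)[OF y(1)] B(2)[of q] q interior_subset[of K] norm_triangle_ineq4[of y q] \<epsilon>
      by (intro mult_right_mono mult_left_mono) auto
    finally show ?thesis using F[OF y(1)] by auto
  qed
  have "continuous_on (frontier K) N"
    unfolding N_def by (intro continuous_intros \<alpha>(1))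
  moreover have "frontier K \<noteq> {}" using small[of 1] by auto
  ultimately obtain x where x: "x \<in> frontier K" "\<And>y. y \<in> frontier K \<Longrightarrow> N x \<le> N y"
    using continuous_attains_inf[of "frontier K" N] compact_frontier[OF K(1)] by auto
  have "N x \<le> 4 * B * \<epsilon>" if "0 < \<epsilon>" "\<epsilon> \<le> 1" for \<epsilon>
    using small[OF that] x(2) by force
  moreover have "0 < min 1 (\<delta> / (4 * B))" "4 * B * min 1 (\<delta> / (4 * B)) \<le> \<delta>" if "\<delta> > 0" for \<delta>
    using that B(1) by (auto simp: min_def field_simps)
  ultimately have "N x \<le> 0 + \<delta>" if "\<delta> > 0" for \<delta>
    using that by (metis add_0 min.cobounded1 order_trans)
  then have "N x \<le> 0" by (rule field_le_epsilon)
  then have "\<alpha> x = x + ((\<alpha> x - x) \<bullet> e) *\<^sub>R e" by (simp add: N_def algebra_simps)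
  then show ?thesis using x(1) that by blast
qed

section \<open>Simplices adapted to a convex body\<close>

lemma exists_unit_orthogonal:
  fixes S :: "'a::euclidean_space set"
  assumes "finite S" "card S < DIM('a)"
  obtains z where "norm z = 1" "\<And>y. y \<in> S \<Longrightarrow> y \<bullet> z = 0"
proof -
  have "dim S < DIM('a)" using dim_le_card[OF span_superset assms(1)] assms(2) by simp
  then obtain x where "x \<noteq> 0" "\<And>y. y \<in> span S \<Longrightarrow> orthogonal x y"
    using orthogonal_to_subspace_exists by blast
  then have "norm (x /\<^sub>R norm x) = 1" "\<And>y. y \<in> S \<Longrightarrow> y \<bullet> (x /\<^sub>R norm x) = 0"
    by (auto simp: orthogonal_def inner_commute span_base)
  then show ?thesis by (rule that)
qed

text \<open>The vectors \<open>v\<close> are edges of a simplex in \<open>K\<close> with one vertex at the base point, chosen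
greedily: each new one reaches as far as possible in a direction orthogonal to its predecessors.
The last of these heights is \<open>h\<close>. By maximality the width of \<open>K\<close> about the base point is at
most \<open>h\<close> in every direction orthogonal to all but the last edge (final conclusion).
Since the heights decrease, the simplex is at the same time quantitatively nondegenerate: its
coordinate functionals, given by the dual vectors \<open>w\<close>, have norm at most a constant over
\<open>h\<close>. The bound on the coordinates of the points of \<open>K\<close> is what keeps the norms of the dual
vectors under control when they are corrected by the next direction.\<close>

lemma greedy_dual_system:
  fixes K :: "'a::euclidean_space set"
  assumes K: "compact K" "interior K \<noteq> {}" and k: "k \<le> DIM('a)"
  obtains v w :: "nat \<Rightarrow> 'a" and h :: real
  where "h > 0" "\<And>j. j < k \<Longrightarrow> p + v j \<in> K"
    "\<And>i j. i < k \<Longrightarrow> j < k \<Longrightarrow> v i \<bullet> w j = (if i = j then 1 else 0)"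
    "\<And>j. j < k \<Longrightarrow> norm (w j) \<le> 2 ^ k / h"
    "\<And>j x. j < k \<Longrightarrow> x \<in> K \<Longrightarrow> \<bar>(x - p) \<bullet> w j\<bar> \<le> 2 ^ k"
    "\<And>x z. x \<in> K \<Longrightarrow> (\<And>j. j < k - 1 \<Longrightarrow> v j \<bullet> z = 0) \<Longrightarrow> \<bar>(x - p) \<bullet> z\<bar> \<le> h * norm z"
  using k
proof (induction k arbitrary: thesis)
  case 0
  obtain B where B: "B > 0" "\<And>x. x \<in> K \<Longrightarrow> norm x \<le> B"
    using compact_imp_bounded[OF K(1)] by (auto simp: bounded_pos)
  show ?case
  proof (rule "0.prems"(1)[of "B + norm p"])
    \<comment> \<open>With no edges chosen, truncated subtraction leaves all directions \<open>z\<close> admissible.\<close>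
    fix x z assume "x \<in> K"
    then have "norm (x - p) \<le> B + norm p"
      using B(2)[of x] norm_triangle_ineq4[of x p] by linarith
    then show "\<bar>(x - p) \<bullet> z\<bar> \<le> (B + norm p) * norm z"
      by (meson Cauchy_Schwarz_ineq2 mult_right_mono norm_ge_zero order_trans)
  qed (use B(1) in \<open>auto intro: add_pos_nonneg\<close>)
next
  case (Suc k)
  obtain v w h where h: "h > 0" and vK: "\<And>j. j < k \<Longrightarrow> p + v j \<in> K"
    and dual: "\<And>i j. i < k \<Longrightarrow> j < k \<Longrightarrow> v i \<bullet> w j = (if i = j then 1 else 0)"
    and nw: "\<And>j. j < k \<Longrightarrow> norm (w j) \<le> 2 ^ k / h"
    and wK: "\<And>j x. j < k \<Longrightarrow> x \<in> K \<Longrightarrow> \<bar>(x - p) \<bullet> w j\<bar> \<le> 2 ^ k"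
    and width: "\<And>x z. x \<in> K \<Longrightarrow> (\<And>j. j < k - 1 \<Longrightarrow> v j \<bullet> z = 0) \<Longrightarrow> \<bar>(x - p) \<bullet> z\<bar> \<le> h * norm z"
    using Suc.IH[OF _ Suc_leD[OF Suc.prems(2)]] by blast
  define Z where "Z = sphere 0 1 \<inter> (\<Inter>j\<in>{..<k}. {z. v j \<bullet> z = 0})"
  have Z_iff: "z \<in> Z \<longleftrightarrow> norm z = 1 \<and> (\<forall>j<k. v j \<bullet> z = 0)" for z
    by (auto simp: Z_def)
  have "compact Z" unfolding Z_def
    by (intro compact_Int_closed closed_INT ballI closed_hyperplane) auto
  moreover have "card (v ` {..<k}) < DIM('a)"
    using card_image_le[of "{..<k}" v] Suc.prems(2) by simp
  then obtain z0 where z0: "z0 \<in> Z"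
    using exists_unit_orthogonal[of "v ` {..<k}"] unfolding Z_iff by (metis finite_imageI finite_lessThan imageI lessThan_iff)
  moreover have "K \<noteq> {}" using K(2) by auto
  ultimately have "\<exists>y\<in>K \<times> Z. \<forall>x\<in>K \<times> Z. (fst x - p) \<bullet> snd x \<le> (fst y - p) \<bullet> snd y"
    using K(1) by (intro continuous_attains_sup compact_Times continuous_intros) auto
  then obtain a z where a: "a \<in> K" and z: "z \<in> Z"
    and max: "\<And>x y. x \<in> K \<Longrightarrow> y \<in> Z \<Longrightarrow> (x - p) \<bullet> y \<le> (a - p) \<bullet> z" by auto
  define h' where "h' = (a - p) \<bullet> z"
  have neg: "- y \<in> Z" if "y \<in> Z" for y using that by (simp add: Z_iff)
  have max_abs: "\<bar>(x - p) \<bullet> y\<bar> \<le> h'" if "x \<in> K" "y \<in> Z" for x y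
    using max[OF that] max[OF that(1) neg[OF that(2)]] by (simp add: h'_def abs_le_iff)
  have "h' > 0"
  proof -
    obtain q r where r: "r > 0" "cball q r \<subseteq> K"
      using K(2) by (metis ex_in_conv mem_interior_cball)
    have "q \<in> K" "q + r *\<^sub>R z0 \<in> K"
      using r z0 by (auto intro!: subsetD[OF r(2)] simp: dist_norm Z_iff)
    then have "\<bar>(q + r *\<^sub>R z0 - p) \<bullet> z0\<bar> \<le> h'" "\<bar>(q - p) \<bullet> z0\<bar> \<le> h'"
      using max_abs z0 by auto
    moreover have "(q + r *\<^sub>R z0 - p) \<bullet> z0 = (q - p) \<bullet> z0 + r"
      using z0 by (simp add: inner_left_distrib inner_diff_left Z_iff norm_eq_1)
    ultimately show ?thesis using r(1) by linarith
  qed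
  \<comment> \<open>The heights decrease because the new direction \<open>z\<close> was admissible at the previous stage.\<close>
  have "h' \<le> h"
    using width[OF a, of z] z by (auto simp: h'_def Z_iff)
  have vz: "v j \<bullet> z = 0" if "j < k" for j using z that by (simp add: Z_iff)
  have nz: "norm z = 1" using z by (simp add: Z_iff)
  \<comment> \<open>The new functional is the inner product with \<open>z\<close>, normalised by the new height; it vanishes
    on the old edges, so subtracting multiples of it from the old functionals restores duality.\<close>
  define v' where "v' = v(k := a - p)"
  define w' where "w' j = (if j = k then z /\<^sub>R h' else w j - ((a - p) \<bullet> w j / h') *\<^sub>R z)" for j
  have xz: "\<bar>(x - p) \<bullet> z / h'\<bar> \<le> 1" if "x \<in> K" for x
    using max_abs[OF that z] \<open>h' > 0\<close> by (simp add: divide_le_eq)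
  show ?case
  proof (rule Suc.prems(1)[of h' v' w'])
    show "h' > 0" by fact
    show "p + v' j \<in> K" if "j < Suc k" for j
      using that a vK[of j] by (auto simp: v'_def)
    show "v' i \<bullet> w' j = (if i = j then 1 else 0)" if "i < Suc k" "j < Suc k" for i j
      using that vz[of i] dual[of i j] \<open>h' > 0\<close>
      by (auto simp: v'_def w'_def inner_diff_right h'_def[symmetric] less_Suc_eq)
    show "norm (w' j) \<le> 2 ^ Suc k / h'" if "j < Suc k" for j
    proof (cases "j = k")
      case True
      have "1 / h' \<le> 2 ^ Suc k / h'"
        using \<open>h' > 0\<close> by (intro divide_right_mono one_le_power) auto
      then show ?thesis using True nz \<open>h' > 0\<close> by (simp add: w'_def divide_simps)
    next
      case False
      with that have j: "j < k" by simp
      have "norm (w' j) \<le> norm (w j) + \<bar>(a - p) \<bullet> w j\<bar> / h'"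
        using norm_triangle_ineq4[of "w j" "((a - p) \<bullet> w j / h') *\<^sub>R z"] False nz \<open>h' > 0\<close>
        by (simp add: w'_def)
      also have "norm (w j) \<le> 2 ^ k / h'"
        using nw[OF j] \<open>h' \<le> h\<close> \<open>h' > 0\<close> by (meson divide_left_mono dual_order.trans mult_pos_pos h zero_le_numeral zero_le_power)
      also have "\<bar>(a - p) \<bullet> w j\<bar> / h' \<le> 2 ^ k / h'"
        using wK[OF j a] \<open>h' > 0\<close> by (intro divide_right_mono) auto
      finally show ?thesis by simp
    qed
    show "\<bar>(x - p) \<bullet> w' j\<bar> \<le> 2 ^ Suc k" if "j < Suc k" "x \<in> K" for j x
    proof (cases "j = k")
      case True
      then have "\<bar>(x - p) \<bullet> w' j\<bar> \<le> 1"
        using xz[OF that(2)] by (simp add: w'_def field_simps)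
      also have "(1::real) \<le> 2 ^ Suc k" by (intro one_le_power) simp
      finally show ?thesis .
    next
      case False
      with that have j: "j < k" by simp
      have "\<bar>(x - p) \<bullet> w' j\<bar> = \<bar>(x - p) \<bullet> w j - ((a - p) \<bullet> w j) * ((x - p) \<bullet> z / h')\<bar>"
        using False by (simp add: w'_def inner_diff_right)
      also have "\<dots> \<le> \<bar>(x - p) \<bullet> w j\<bar> + \<bar>(a - p) \<bullet> w j\<bar> * \<bar>(x - p) \<bullet> z / h'\<bar>"
        by (metis abs_mult abs_triangle_ineq4)
      also have "\<dots> \<le> 2 ^ k + 2 ^ k * 1"
        using wK[OF j that(2)] wK[OF j a] xz[OF that(2)] by (intro add_mono mult_mono) auto
      finally show ?thesis by simp
    qed
    show "\<bar>(x - p) \<bullet> y\<bar> \<le> h' * norm y" if "x \<in> K" "\<And>j. j < Suc k - 1 \<Longrightarrow> v' j \<bullet> y = 0" for x y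
    proof (cases "y = 0")
      case False
      have "v j \<bullet> y = 0" if "j < k" for j
        using \<open>\<And>j. j < Suc k - 1 \<Longrightarrow> v' j \<bullet> y = 0\<close>[of j] that by (simp add: v'_def)
      then have "y /\<^sub>R norm y \<in> Z" using False by (auto simp: Z_iff)
      from max_abs[OF \<open>x \<in> K\<close> this] show ?thesis
        using False by (simp add: abs_mult field_simps)
    qed simp
  qed
qed

section \<open>Lower bounds for the area\<close>

text \<open>The coordinate map \<open>x \<mapsto> (x - p) \<bullet> w j\<close> into \<open>n\<close>-space is Lipschitz and its image of \<open>M\<close>
contains a cube, so every cover of \<open>M\<close> yields a cover of the cube by boxes of comparable size
whose total volume is at least that of the cube. As the ambient space has dimension \<open>n + 1\<close>, all
boxes carry a unit interval in one spare direction \<open>b0\<close>, which makes their \<open>(n + 1)\<close>-dimensional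
Lebesgue measure equal to the \<open>n\<close>-dimensional volume needed.\<close>

lemma hausdorff_measure_ge_coordinates:
  fixes M :: "'a::euclidean_space set" and w :: "nat \<Rightarrow> 'a"
  assumes dim: "DIM('a) = n + 1" and n: "n \<ge> 1" and L: "L > 0" "\<And>j. j < n \<Longrightarrow> norm (w j) \<le> L"
    and cube: "\<And>y. (\<And>j. j < n \<Longrightarrow> 0 \<le> y j \<and> y j \<le> 1 / real n) \<Longrightarrow>
      \<exists>x\<in>M. \<forall>j<n. (x - p) \<bullet> w j = y j"
  shows "ennreal (unit_ball_vol (real n) / (4 * L * real n) ^ n) \<le> hausdorff_measure n M"
proof -
  obtain b0 :: 'a where b0: "b0 \<in> Basis" using nonempty_Basis by blast
  have "card (Basis - {b0}) = n" using b0 dim by simp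
  then obtain \<beta> where \<beta>: "bij_betw \<beta> (Basis - {b0}) {0..<n}"
    using ex_bij_betw_finite_nat[of "Basis - {b0}"] by auto
  have \<beta>_less: "\<beta> b < n" if "b \<in> Basis" "b \<noteq> b0" for b
    using bij_betwE[OF \<beta>] that by auto
  define vec :: "('a \<Rightarrow> real) \<Rightarrow> 'a" where "vec f = (\<Sum>b\<in>Basis. f b *\<^sub>R b)" for f
  have vec: "vec f \<bullet> b = f b" if "b \<in> Basis" for f b
    using that by (simp add: vec_def)
  have box_measure: "emeasure lborel (cbox (vec (\<lambda>b. if b = b0 then 0 else l b))
      (vec (\<lambda>b. if b = b0 then 1 else l b + r))) = ennreal (r ^ n)" if "r \<ge> 0" for l r
  proof -
    have "emeasure lborel (cbox (vec (\<lambda>b. if b = b0 then 0 else l b))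
        (vec (\<lambda>b. if b = b0 then 1 else l b + r))) = ennreal (\<Prod>b\<in>Basis. if b = b0 then 1 else r)"
      using that by (subst emeasure_lborel_cbox) (auto simp: vec inner_diff_left intro!: arg_cong[of _ _ ennreal] prod.cong)
    also have "(\<Prod>b\<in>Basis. if b = b0 then 1 else r) = (\<Prod>b\<in>Basis - {b0}. r)"
      using b0 by (subst prod.remove[of _ b0]) (auto intro!: prod.cong)
    also have "\<dots> = r ^ n" using b0 dim by simp
    finally show ?thesis .
  qed
  have "ennreal (unit_ball_vol (real n) / (4 * L * real n) ^ n) \<le> hausdorff_premeasure n 1 M"
    unfolding hausdorff_premeasure_def
  proof (rule INF_greatest)
    fix C :: "nat \<Rightarrow> 'a set"
    assume "C \<in> {C. M \<subseteq> (\<Union>i. C i) \<and> (\<forall>i. bounded (C i) \<and> diameter (C i) \<le> 1)}"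
    then have cover: "M \<subseteq> (\<Union>i. C i)" and bd: "\<And>i. bounded (C i)" by auto
    define d where "d i = diameter (C i)" for i
    have d: "d i \<ge> 0" for i unfolding d_def using bd by (rule diameter_ge_0)
    define c where "c i = (SOME x. x \<in> C i)" for i
    have c: "c i \<in> C i" if "x \<in> C i" for i x using that unfolding c_def by (rule someI)
    define l where "l i b = (c i - p) \<bullet> w (\<beta> b) - L * d i" for i b
    define R where "R i = (if C i = {} then {} else
      cbox (vec (\<lambda>b. if b = b0 then 0 else l i b)) (vec (\<lambda>b. if b = b0 then 1 else l i b + 2 * L * d i)))" for i
    have R_measure: "emeasure lborel (R i) = (if C i = {} then 0 else ennreal ((2 * L * d i) ^ n))" for i
      using box_measure[of "2 * L * d i" "l i"] d[of i] L(1) by (simp add: R_def)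
    let ?Q = "cbox (vec (\<lambda>b. if b = b0 then 0 else 0)) (vec (\<lambda>b. if b = b0 then 1 else 0 + 1 / real n))"
    have "?Q \<subseteq> (\<Union>i. R i)"
    proof
      fix y assume y: "y \<in> ?Q"
      have y0: "0 \<le> y \<bullet> b0" "y \<bullet> b0 \<le> 1" using y b0 by (auto simp: mem_box vec)
      have yb: "0 \<le> y \<bullet> b \<and> y \<bullet> b \<le> 1 / real n" if "b \<in> Basis" "b \<noteq> b0" for b
        using y that by (auto simp: mem_box vec)
      have inv: "inv_into (Basis - {b0}) \<beta> j \<in> Basis - {b0}" if "j < n" for j
        using that \<beta> by (intro inv_into_into) (auto simp: bij_betw_def)
      obtain x where x: "x \<in> M" "\<And>j. j < n \<Longrightarrow> (x - p) \<bullet> w j = y \<bullet> inv_into (Basis - {b0}) \<beta> j"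
        using cube[of "\<lambda>j. y \<bullet> inv_into (Basis - {b0}) \<beta> j"] yb inv by blast
      obtain i where i: "x \<in> C i" using x(1) cover by auto
      have "dist x (c i) \<le> d i"
        unfolding d_def by (rule diameter_bounded_bound[OF bd i c[OF i]])
      have "\<bar>y \<bullet> b - (c i - p) \<bullet> w (\<beta> b)\<bar> \<le> L * d i" if b: "b \<in> Basis" "b \<noteq> b0" for b
      proof -
        have "inv_into (Basis - {b0}) \<beta> (\<beta> b) = b"
          using b \<beta> by (intro inv_into_f_f) (auto simp: bij_betw_def)
        then have "y \<bullet> b - (c i - p) \<bullet> w (\<beta> b) = (x - c i) \<bullet> w (\<beta> b)"
          using x(2)[OF \<beta>_less[OF b]] by (simp add: inner_diff_left)
        also have "\<bar>\<dots>\<bar> \<le> norm (x - c i) * norm (w (\<beta> b))" by (rule Cauchy_Schwarz_ineq2)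
        also have "\<dots> \<le> d i * L"
          using \<open>dist x (c i) \<le> d i\<close> L(2)[OF \<beta>_less[OF b]] d[of i]
          by (intro mult_mono) (auto simp: dist_norm)
        finally show ?thesis by (simp add: mult.commute)
      qed
      then have "y \<in> R i"
        using i y0 by (fastforce simp: R_def mem_box vec l_def abs_le_iff)
      then show "y \<in> (\<Union>i. R i)" by blast
    qed
    have "ennreal ((1 / real n) ^ n) = emeasure lborel ?Q"
      using box_measure[of "1 / real n" "\<lambda>_. 0"] by simp
    also have "\<dots> \<le> emeasure lborel (\<Union>i. R i)"
      using \<open>?Q \<subseteq> (\<Union>i. R i)\<close> by (intro emeasure_mono) (auto simp: R_def)
    also have "\<dots> \<le> (\<Sum>i. emeasure lborel (R i))"
      by (intro emeasure_subadditive_countably) (auto simp: R_def)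
    finally have *: "ennreal ((1 / real n) ^ n) \<le> (\<Sum>i. emeasure lborel (R i))" .
    let ?k = "unit_ball_vol (real n) / (4 * L) ^ n"
    have "?k \<ge> 0" using L(1) by simp
    have "ennreal (unit_ball_vol (real n) / (4 * L * real n) ^ n) = ennreal ?k * ennreal ((1 / real n) ^ n)"
      using \<open>?k \<ge> 0\<close> by (simp add: power_mult_distrib power_divide flip: ennreal_mult)
    also have "\<dots> \<le> ennreal ?k * (\<Sum>i. emeasure lborel (R i))" using * by (rule mult_left_mono) simp
    also have "\<dots> = (\<Sum>i. ennreal ?k * emeasure lborel (R i))" by simp
    also have "\<dots> = (\<Sum>i. if C i = {} then 0 else ennreal (unit_ball_vol (real n) * (diameter (C i) / 2) ^ n))"
    proof (rule suminf_cong)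
      fix i
      have "?k * (2 * L * d i) ^ n = unit_ball_vol (real n) * (2 * L * d i / (4 * L)) ^ n"
        by (simp only: power_divide times_divide_eq_left times_divide_eq_right)
      also have "2 * L * d i / (4 * L) = diameter (C i) / 2"
        using L(1) by (simp add: d_def)
      finally have "?k * (2 * L * d i) ^ n = unit_ball_vol (real n) * (diameter (C i) / 2) ^ n" .
      then show "ennreal ?k * emeasure lborel (R i)
          = (if C i = {} then 0 else ennreal (unit_ball_vol (real n) * (diameter (C i) / 2) ^ n))"
        using \<open>?k \<ge> 0\<close> L(1) d[of i] by (simp add: R_measure flip: ennreal_mult)
    qed
    finally show "ennreal (unit_ball_vol (real n) / (4 * L * real n) ^ n)
      \<le> (\<Sum>i. if C i = {} then 0 else ennreal (unit_ball_vol (real n) * (diameter (C i) / 2) ^ n))" .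
  qed
  also have "\<dots> \<le> hausdorff_measure n M"
    unfolding hausdorff_measure_def by (rule SUP_upper) simp
  finally show ?thesis .
qed

text \<open>The number \<open>h\<close> is the last height of a greedily chosen \<open>n\<close>-dimensional simplex in \<open>K\<close>. The
shadow of \<open>K\<close> on the span of the simplex contains the simplex and thus has volume at least
of order \<open>h ^ n\<close>; the frontier covers this shadow. Two directions \<open>e\<close> and \<open>f\<close> remain that are
orthogonal to all edges but the last, and in these \<open>K\<close> has width of order \<open>h\<close>.\<close>

lemma area_ge_two_widths:
  fixes K :: "'a::euclidean_space set"
  assumes dim: "DIM('a) = n + 1" and n: "n \<ge> 1"
    and K: "compact K" "convex K" "interior K \<noteq> {}"
  obtains p e f :: 'a and h :: real
  where "h > 0" "norm e = 1" "norm f = 1" "e \<bullet> f = 0"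
    "\<And>z. z \<in> K \<Longrightarrow> \<bar>(z - p) \<bullet> e\<bar> \<le> h" "\<And>z. z \<in> K \<Longrightarrow> \<bar>(z - p) \<bullet> f\<bar> \<le> h"
    "hausdorff_measure n (frontier K)
       \<ge> ennreal (unit_ball_vol (real n) / (4 * 2 ^ n * real n) ^ n * h ^ n)"
proof -
  have "n \<le> DIM('a)" using dim by simp
  obtain p where p: "p \<in> K" using K(3) interior_subset by blast
  obtain v w :: "nat \<Rightarrow> 'a" and h :: real where h: "h > 0" and vK: "\<And>j. j < n \<Longrightarrow> p + v j \<in> K"
    and dual: "\<And>i j. i < n \<Longrightarrow> j < n \<Longrightarrow> v i \<bullet> w j = (if i = j then 1 else 0)"
    and nw: "\<And>j. j < n \<Longrightarrow> norm (w j) \<le> 2 ^ n / h"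
    and "\<And>j x. j < n \<Longrightarrow> x \<in> K \<Longrightarrow> \<bar>(x - p) \<bullet> w j\<bar> \<le> 2 ^ n"
    and width: "\<And>x z. x \<in> K \<Longrightarrow> (\<And>j. j < n - 1 \<Longrightarrow> v j \<bullet> z = 0) \<Longrightarrow> \<bar>(x - p) \<bullet> z\<bar> \<le> h * norm z"
    by (rule greedy_dual_system[OF K(1,3) \<open>n \<le> DIM('a)\<close>, of p]) (rule that, assumption+, blast)
  have "card (v ` {..<n}) < DIM('a)" using card_image_le[of "{..<n}" v] dim by simp
  then obtain e where e: "norm e = 1" "\<And>y. y \<in> v ` {..<n} \<Longrightarrow> y \<bullet> e = 0"
    using exists_unit_orthogonal[of "v ` {..<n}"] by auto
  have "card (insert e (v ` {..<n - 1})) < DIM('a)"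
    using card_image_le[of "{..<n - 1}" v] card_insert_le_m1[of n "v ` {..<n - 1}" e] dim n by simp
  then obtain f where f: "norm f = 1" "\<And>y. y \<in> insert e (v ` {..<n - 1}) \<Longrightarrow> y \<bullet> f = 0"
    using exists_unit_orthogonal[of "insert e (v ` {..<n - 1})"] by auto
  have "ennreal (unit_ball_vol (real n) / (4 * (2 ^ n / h) * real n) ^ n) \<le> hausdorff_measure n (frontier K)"
  proof (rule hausdorff_measure_ge_coordinates[OF dim n _ nw])
    fix y :: "nat \<Rightarrow> real"
    assume y: "\<And>j. j < n \<Longrightarrow> 0 \<le> y j \<and> y j \<le> 1 / real n"
    have n0: "real n > 0" using n by simp
    define x where "x = p + (\<Sum>j<n. y j *\<^sub>R v j)"
    \<comment> \<open>The point with coordinates \<open>y\<close> is the average of the points that move from \<open>p\<close> along the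
      \<open>j\<close>-th edge by the fraction \<open>real n * y j\<close>; this is why the cube has side \<open>1 / real n\<close>.\<close>
    have "(\<Sum>j<n. (1 / real n) *\<^sub>R ((1 - real n * y j) *\<^sub>R p + (real n * y j) *\<^sub>R (p + v j))) \<in> K"
      using n0 y vK p by (intro convex_sum[OF _ K(2)] convexD[OF K(2)]) (auto simp: field_simps)
    also have "(\<Sum>j<n. (1 / real n) *\<^sub>R ((1 - real n * y j) *\<^sub>R p + (real n * y j) *\<^sub>R (p + v j)))
        = (\<Sum>j<n. (1 / real n) *\<^sub>R p + y j *\<^sub>R v j)"
      using n0 by (intro sum.cong) (auto simp: algebra_simps)
    also have "\<dots> = x" using n0 by (simp add: x_def sum.distrib scaleR_sum_left[symmetric] del: scaleR_sum_left)
    finally have xK: "x \<in> K" .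
    \<comment> \<open>Some direction \<open>g\<close> leaves all coordinates unchanged; along it the frontier is reached.\<close>
    have "card (w ` {..<n}) < DIM('a)" using card_image_le[of "{..<n}" w] dim by simp
    then obtain g where g: "norm g = 1" "\<And>y. y \<in> w ` {..<n} \<Longrightarrow> y \<bullet> g = 0"
      using exists_unit_orthogonal[of "w ` {..<n}"] by auto
    have "\<exists>t. x + t *\<^sub>R g \<in> frontier K"
    proof (cases "x \<in> interior K")
      case True
      have "g \<noteq> 0" using g(1) by auto
      then show ?thesis using ray_to_frontier[OF compact_imp_bounded[OF K(1)] True] by metis
    next
      case False
      then have "x + 0 *\<^sub>R g \<in> frontier K"
        using xK closure_subset by (auto simp: frontier_def)
      then show ?thesis by blast
    qed
    then obtain t where t: "x + t *\<^sub>R g \<in> frontier K" by blast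
    have "(x + t *\<^sub>R g - p) \<bullet> w j = y j" if j: "j < n" for j
    proof -
      have "(x + t *\<^sub>R g - p) \<bullet> w j = (\<Sum>i<n. y i * (v i \<bullet> w j)) + t * (w j \<bullet> g)"
        by (simp add: x_def inner_left_distrib inner_sum_left inner_commute[of "w j" g])
      also have "(\<Sum>i<n. y i * (v i \<bullet> w j)) = (\<Sum>i<n. if i = j then y i else 0)"
        using dual j by (intro sum.cong) auto
      finally show ?thesis using j g(2)[of "w j"] by simp
    qed
    then show "\<exists>x\<in>frontier K. \<forall>j<n. (x - p) \<bullet> w j = y j" using t by blast
  qed (use h in auto)
  also have "unit_ball_vol (real n) / (4 * (2 ^ n / h) * real n) ^ n
      = unit_ball_vol (real n) / (4 * 2 ^ n * real n) ^ n * h ^ n"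
    using h by (simp add: power_divide power_mult_distrib)
  finally show ?thesis
    using e f h width[of _ e] width[of _ f] by (intro that[of h e f p]) auto
qed

section \<open>Area and displacement\<close>

theorem proposition4p1:
  fixes n :: nat
  assumes "n \<ge> 1" and "CARD('m::finite) = n + 1"
  shows "\<exists>(h::real) (B :: real \<Rightarrow> real).
    h > 0 \<and> continuous_on {1..} B \<and> B ` {1..} \<subseteq> {h..} \<and>
    (\<forall>(M :: (real ^ 'm) set) (\<alpha> :: real ^ 'm \<Rightarrow> real ^ 'm).
       closed_convex_hypersurface M \<and> continuous_on M \<alpha> \<and> \<alpha> ` M \<subseteq> M \<and> (\<forall>x\<in>M. \<alpha> x \<noteq> x) \<longrightarrow>
       hausdorff_measure n M
         > ennreal (B (enn2real (max_distortion M \<alpha>))) * min_displacement M \<alpha> ^ n)"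
proof -
  define c where "c = unit_ball_vol (real n) / (4 * 2 ^ n * real n) ^ n"
  \<comment> \<open>The denominator makes room for the constant 48 in the displacement bound; the factor 2 turns
    the weak inequality into a strict one.\<close>
  define b where "b = c / (2 * 48 ^ n)"
  have c: "c > 0" and b: "b > 0" using assms(1) by (simp_all add: c_def b_def)
  have dim: "DIM(real ^ 'm) = n + 1" using assms(2) by simp
  have "hausdorff_measure n M > ennreal b * min_displacement M \<alpha> ^ n"
    if M: "closed_convex_hypersurface M" "continuous_on M \<alpha>" "\<alpha> ` M \<subseteq> M"
    for M :: "(real ^ 'm) set" and \<alpha>
  proof -
    obtain K where K: "compact K" "convex K" "interior K \<noteq> {}" and MK: "M = frontier K"
      using M(1) by (auto simp: closed_convex_hypersurface_def)
    obtain p e f h where h: "h > 0" and frame: "norm e = 1" "norm f = 1" "e \<bullet> f = 0"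
      and width: "\<And>z. z \<in> K \<Longrightarrow> \<bar>(z - p) \<bullet> e\<bar> \<le> h" "\<And>z. z \<in> K \<Longrightarrow> \<bar>(z - p) \<bullet> f\<bar> \<le> h"
      and area: "ennreal (c * h ^ n) \<le> hausdorff_measure n M"
      using area_ge_two_widths[OF dim assms(1) K] unfolding c_def MK by metis
    obtain x s where x: "x \<in> M" "\<alpha> x = x + s *\<^sub>R e"
      using exists_displacement_parallel[OF K _ _ frame(1)] M(2,3) unfolding MK by metis
    have "intrinsic_dist M x (\<alpha> x) \<le> ennreal (48 * h)"
    proof (cases "s \<ge> 0")
      case True
      then show ?thesis
        using intrinsic_dist_le_width[OF K(1,2) frame width, of x "\<alpha> x" s] x M(3) h unfolding MK by auto
    next
      case False
      then show ?thesis
        using intrinsic_dist_le_width[OF K(1,2), of "- e" f p h x "\<alpha> x" "- s"] frame width x M(3) h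
        unfolding MK by auto
    qed
    moreover have "min_displacement M \<alpha> \<le> intrinsic_dist M x (\<alpha> x)"
      unfolding min_displacement_def using x(1) by (rule INF_lower)
    ultimately have "min_displacement M \<alpha> ^ n \<le> ennreal (48 * h) ^ n"
      by (intro power_mono) auto
    then have "ennreal b * min_displacement M \<alpha> ^ n \<le> ennreal b * ennreal (48 * h) ^ n"
      by (rule mult_left_mono) simp
    also have "\<dots> = ennreal (b * (48 * h) ^ n)"
      using b h by (simp add: ennreal_power flip: ennreal_mult)
    also have "b * (48 * h) ^ n = c * h ^ n / 2" by (simp add: b_def power_mult_distrib)
    also have "ennreal (c * h ^ n / 2) < ennreal (c * h ^ n)"
      using c h by (intro ennreal_lessI) auto
    also note area
    finally show ?thesis .
  qed
  then show ?thesis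
    using b by (intro exI[of _ b] exI[of _ "\<lambda>_. b"]) auto
qed

end
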